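(* Let $s \in \mathbb{N}$. Then the Devil player has a winning strategy in the Sneaky Angel and Devil game with parameter $s$, i.e. in the game in which the Angel is $s$-sneaky.
   Context: **Angel and Devil game.** The board is $\mathbb{Z}\times\mathbb{Z}$, whose elements are called squares. The Angel player controls an Angel piece which starts on $(0,0)$ and moves like a chess king: from $(x,y)$ it moves to one of the eight squares $(x+i,y+j)$ with $i,j\in\{-1,0,1\}$, $(i,j)\neq(0,0)$. On each turn the Devil player deletes one square of the board. The Angel piece may not move to a square that has already been deleted. The Devil may delete the square currently occupied by the Angel piece, but the game only ends if the Angel has no legal move. The Angel must move on every turn (passing is not allowed). The Devil wins if the Angel piece at some point has no legal move on the Angel's turn; the Angel wins if there is always some legal move for them to make. **Sneaky Angel and Devil game with parameter $s\in\{0,1,2,\dots\}$ (the Angel is $s$-sneaky).** The game is played with the rules of the Angel and Devil game (the board is $\mathbb{Z}\times\mathbb{Z}$, the Angel piece starts on $(0,0)$, must make a chess-king move to a non-deleted square on each of its turns, the Devil deletes one square, possibly the one occupied by the Angel piece, on each of its turns, the Devil wins if the Angel piece at some point has no legal move on the Angel's turn, and the Angel wins otherwise), with the following timing and information. First the Angel makes $s$ moves without any interference from the Devil. The Devil then deletes a first square with no knowledge of the Angel's moves (knowing only the starting position $(0,0)$). Then the Angel makes one more move, the Devil learns the Angel's first move, and the Devil deletes another square; and so on, each new Angel move revealing one more Angel move to the Devil. Thus when the Devil makes the $j$-th deletion ($j\ge 1$), the Angel has made $s+j-1$ moves, and the Devil knows exactly the Angel's positions after $0,1,\dots,j-1$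 moves. **Strategies.** A strategy for the Devil is a function which, at each of the Devil's turns, deterministically outputs the square to delete from the Devil's current knowledge (the revealed Angel moves and the squares deleted so far). It is a winning strategy if the Devil, following it, wins against every possible sequence of legal Angel moves. *)

theory Defs
  imports Main
begin

type_synonym square = "int \<times> int"

definition king_move :: "square \<Rightarrow> square \<Rightarrow> bool" where
  "king_move a b \<longleftrightarrow>
     (\<exists>i\<in>{-1, 0, 1}. \<exists>j\<in>{-1, 0, 1}. (i, j) \<noteq> (0, 0) \<and> b = (fst a + i, snd a + j))"

text \<open>
  A strategy receives the list of revealed Angel positions (in order, starting with the initial
  square) and the list of squares deleted so far (in order). A square can be deleted only once.
\<close>

type_synonym strategy = "square list \<Rightarrow> square list \<Rightarrow> square"

definition devil_strategy :: "strategy \<Rightarrow> bool" where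
  "devil_strategy \<sigma> \<longleftrightarrow> (\<forall>revealed deleted. \<sigma> revealed deleted \<notin> set deleted)"

text \<open>
  The first \<open>j\<close> deletions when the Angel's position after \<open>n\<close> moves is \<open>p n\<close>. For deletion number
  \<open>j + 1\<close> the Devil knows exactly \<open>p 0, \<dots>, p j\<close>, whatever the value of the parameter \<open>s\<close>.
\<close>

primrec deletions :: "strategy \<Rightarrow> (nat \<Rightarrow> square) \<Rightarrow> nat \<Rightarrow> square list" where
  "deletions \<sigma> p 0 = []"
| "deletions \<sigma> p (Suc j) =
     deletions \<sigma> p j @ [\<sigma> (map p [0..<Suc j]) (deletions \<sigma> p j)]"

text \<open>
  It is legal for the Angel to go to \<open>q\<close> with move number \<open>n + 1\<close>, from \<open>p n\<close>. The Devil has then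
  made \<open>n + 1 - s\<close> deletions, where truncated subtraction gives \<open>0\<close> during the first \<open>s\<close> moves.
  These deletions depend only on \<open>p 0, \<dots>, p n\<close>.
\<close>

definition angel_legal :: "nat \<Rightarrow> strategy \<Rightarrow> (nat \<Rightarrow> square) \<Rightarrow> nat \<Rightarrow> square \<Rightarrow> bool" where
  "angel_legal s \<sigma> p n q \<longleftrightarrow> king_move (p n) q \<and> q \<notin> set (deletions \<sigma> p (Suc n - s))"

definition angel_stuck :: "nat \<Rightarrow> strategy \<Rightarrow> (nat \<Rightarrow> square) \<Rightarrow> nat \<Rightarrow> bool" where
  "angel_stuck s \<sigma> p n \<longleftrightarrow> \<not> (\<exists>q. angel_legal s \<sigma> p n q)"

text \<open>
  A sequence of legal Angel moves, continued for as long as the Angel has a legal move. The game is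
  over at the first \<open>n\<close> at which the Angel is stuck; the values of \<open>p\<close> after this \<open>n\<close> are padding.
\<close>

definition angel_play :: "nat \<Rightarrow> strategy \<Rightarrow> (nat \<Rightarrow> square) \<Rightarrow> bool" where
  "angel_play s \<sigma> p \<longleftrightarrow>
     p 0 = (0, 0) \<and>
     (\<forall>n. (\<forall>m\<le>n. \<not> angel_stuck s \<sigma> p m) \<longrightarrow> angel_legal s \<sigma> p n (p (Suc n)))"

definition devil_wins :: "nat \<Rightarrow> strategy \<Rightarrow> (nat \<Rightarrow> square) \<Rightarrow> bool" where
  "devil_wins s \<sigma> p \<longleftrightarrow> (\<exists>n. angel_stuck s \<sigma> p n)"

definition winning_devil_strategy :: "nat \<Rightarrow> strategy \<Rightarrow> bool" where
  "winning_devil_strategy s \<sigma> \<longleftrightarrow>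
     devil_strategy \<sigma> \<and> (\<forall>p. angel_play s \<sigma> p \<longrightarrow> devil_wins s \<sigma> p)"

end

theory Submission imports Defs begin

text \<open>
  The Devil fences the Angel in with the boundary of a square box of half-width \<open>H\<close> around
  the origin. Being \<open>s\<close> moves behind, he must delete each square of this fence before the
  last revealed position comes within king distance \<open>s\<close> of it. An Angel that can never step
  on the fence stays in the box, and the Devil can use his idle turns to delete the squares of the box:
  once they are all gone, there is nowhere left to go.

  Deleting the fence in time is a scheduling problem with one deletion per turn. Its difficulty is that
  an Angel coming from distance \<open>d\<close> reaches about \<open>2 d\<close> squares of a straight
  fence, while the Devil has only \<open>d\<close> turns. So the fence is thinned out gradually. Its
  squares are graded by the residue of their position along the side modulo \<open>M = m + 5\<close>. A
  square of residue \<open>r < m\<close> has level \<open>r\<close> and becomes urgent when the Angel is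
  within \<open>B * 2 ^ r\<close> of it. The remaining five residues, and the parts of the fence near
  the corners, have level \<open>m\<close> and are urgent from the beginning. The Devil always deletes
  an urgent square of the highest level.

  Level \<open>m\<close> contains little more than \<open>8 H * 5 / M\<close> squares, so if
  \<open>M\<close> exceeds \<open>40\<close> and \<open>H\<close> is large, it is finished before the
  Angel comes close to the fence. Suppose now that a square \<open>u\<close> is late at time
  \<open>t\<close>. Consider the longest period ending at \<open>t\<close> in which each turn was spent
  on an urgent square of at least the level of \<open>u\<close>, and let \<open>n\<close> be its length.
  The squares deleted in it lie on one side of the fence, because the period turns out to be short and
  the corners are already gone. A level \<open>r\<close> whose radius covered the fence throughout the
  period contributes at most \<open>n / M + 2\<close> of them, since the covered interval moves by at
  most \<open>n\<close>; a level whose radius did not yet reach the fence at some moment of the period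
  contributes up to \<open>2 * B * 2 ^ r / M\<close> more. In this second case the Angel has since
  walked a distance close to \<open>B * 2 ^ r\<close>, so \<open>B * 2 ^ r \<le> s + n\<close>, and as
  the radii form a geometric sequence they add up to at most \<open>2 * (s + n)\<close>. Altogether
  \<open>M * n \<le> m * (n + 2 * M) + 4 * (s + n)\<close>, that is, \<open>n \<le> 2 m M + 4 s\<close>:
  here the five residues deleted in advance outweigh the \<open>4 n\<close> caused by the approach. But
  \<open>u\<close> itself had been urgent for at least \<open>B - s\<close> turns, which is longer.

  The counts are in \<open>card_residue_class\<close>, \<open>card_newly_covered\<close>,
  \<open>geometric_sum_below\<close> and \<open>card_top_level\<close>; the scheduling argument is
  \<open>fence_deleted_in_time\<close>.
\<close>

section \<open>King distance\<close>

definition king_dist :: "square \<Rightarrow> square \<Rightarrow> int" where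
  "king_dist a b = max \<bar>fst a - fst b\<bar> \<bar>snd a - snd b\<bar>"

lemma king_dist_triangle: "king_dist a c \<le> king_dist a b + king_dist b c"
  unfolding king_dist_def by linarith

lemma king_dist_sym: "king_dist a b = king_dist b a"
  unfolding king_dist_def by linarith

lemma king_move_dist: "king_move a b \<Longrightarrow> king_dist a b \<le> 1"
  unfolding king_move_def king_dist_def by auto

lemma king_path_dist:
  assumes "\<And>n. king_move (p n) (p (Suc n))"
  shows "king_dist (p i) (p (i + k)) \<le> int k"
proof (induction k)
  case 0
  then show ?case by (simp add: king_dist_def)
next
  case (Suc k)
  have "king_dist (p (i + k)) (p (i + Suc k)) \<le> 1"
    using king_move_dist[OF assms[of "i + k"]] by simp
  then show ?case
    using Suc king_dist_triangle[of "p i" "p (i + Suc k)" "p (i + k)"] by simp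
qed

lemma king_path_dist_le:
  assumes "\<And>n. king_move (p n) (p (Suc n))" and "i \<le> j"
  shows "king_dist (p i) (p j) \<le> int j - int i"
  using king_path_dist[of p i "j - i"] assms by (simp add: of_nat_diff)

section \<open>Counting residues\<close>

lemma finite_interval_filter: "finite {k \<in> {a..b :: int}. P k}"
  by (rule finite_subset[of _ "{a..b}"]) auto

text \<open>
  The hypothesis allows empty intervals that are not too reversed, for which the bound is still
  nonnegative.
\<close>

lemma card_residue_class:
  fixes a b M r :: int
  assumes "M > 0" and "a \<le> b + M"
  shows "M * int (card {k \<in> {a..b}. k mod M = r}) \<le> b - a + M"
proof -
  define lo where "lo = - ((r - a) div M)"
  define hi where "hi = (b - r) div M"
  have "{k \<in> {a..b}. k mod M = r} \<subseteq> (\<lambda>q. M * q + r) ` {lo..hi}"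
  proof
    fix k assume "k \<in> {k \<in> {a..b}. k mod M = r}"
    then have k: "a \<le> k" "k \<le> b" "k = M * (k div M) + r"
      by (auto simp: mult_div_mod_eq)
    have "(k div M) * M \<le> b - r" using k by (simp add: mult.commute)
    then have 1: "k div M \<le> hi"
      using zdiv_mono1[of "(k div M) * M" "b - r" M] assms(1) unfolding hi_def by simp
    have "r - a \<ge> (- (k div M)) * M" using k by (simp add: mult.commute)
    moreover have "(- (k div M)) * M div M = - (k div M)"
      using assms(1) by (intro nonzero_mult_div_cancel_right) simp
    ultimately have "(r - a) div M \<ge> - (k div M)"
      using assms(1) zdiv_mono1[of "(- (k div M)) * M" "r - a" M] by simp
    then have "lo \<le> k div M" unfolding lo_def by linarith
    with 1 k(3) show "k \<in> (\<lambda>q. M * q + r) ` {lo..hi}" by auto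
  qed
  then have "card {k \<in> {a..b}. k mod M = r} \<le> card ((\<lambda>q. M * q + r) ` {lo..hi})"
    by (intro card_mono) auto
  also have "\<dots> \<le> card {lo..hi}" by (rule card_image_le) simp
  finally have c: "card {k \<in> {a..b}. k mod M = r} \<le> nat (hi - lo + 1)" by simp
  show ?thesis
  proof (cases "hi - lo + 1 \<ge> 0")
    case True
    have "M * int (card {k \<in> {a..b}. k mod M = r}) \<le> M * (hi - lo + 1)"
      using c True assms(1) by (intro mult_left_mono) auto
    also have "\<dots> = M * ((b - r) div M) + M * ((r - a) div M) + M"
      by (simp add: hi_def lo_def algebra_simps)
    also have "\<dots> \<le> (b - r) + (r - a) + M"
    proof -
      have *: "M * (x div M) \<le> x" for x :: int
        using pos_mod_sign[OF assms(1), of x] mult_div_mod_eq[of M x] by linarith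
      show ?thesis using *[of "b - r"] *[of "r - a"] by linarith
    qed
    finally show ?thesis by simp
  next
    case False
    then have "card {k \<in> {a..b}. k mod M = r} = 0" using c by linarith
    then show ?thesis using assms by simp
  qed
qed

text \<open>A geometric sum with ratio 2 is less than twice its largest term.\<close>

lemma geometric_sum_below:
  fixes B N :: int
  assumes "B \<ge> 0" and "N \<ge> 0"
  shows "(\<Sum>r<m. if B * 2 ^ r \<le> N then B * 2 ^ r else 0) \<le> 2 * N"
    and "(\<Sum>r<m. if P r then B * 2 ^ r else 0) \<le> B * 2 ^ m"
proof -
  show gen: "(\<Sum>r<m. if P r then B * 2 ^ r else 0) \<le> B * 2 ^ m" for P m
  proof (induction m)
    case (Suc m)
    moreover have "B * 2 ^ m \<ge> 0" using assms(1) by simp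
    ultimately show ?case by simp
  qed (use assms(1) in simp)
  show "(\<Sum>r<m. if B * 2 ^ r \<le> N then B * 2 ^ r else 0) \<le> 2 * N"
  proof (induction m)
    case 0
    then show ?case using assms by simp
  next
    case (Suc m)
    then show ?case using gen[of "\<lambda>r. B * 2 ^ r \<le> N" m] by auto
  qed
qed

text \<open>
  In the application \<open>\<phi>\<close> is the Angel's coordinate along a side of the fence, \<open>\<gamma>\<close> its signed
  distance from that side, and \<open>K\<close> the set of positions of residue \<open>r\<close> that were out of reach at
  time \<open>a\<close> but came within distance \<open>R\<close> by time \<open>a + n\<close>. As long as \<open>\<bar>\<gamma>\<bar> \<le> R\<close>, the covered
  positions are the interval of radius \<open>R\<close> around \<open>\<phi>\<close>, and the new ones lie in two intervals, to the
  left and to the right of the one at time \<open>a\<close>, of total length at most \<open>n\<close>. Otherwise the side may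
  have been wholly out of reach at time \<open>a\<close>, and an interval of length \<open>2 * R + n\<close> has to be allowed.
\<close>

lemma card_newly_covered:
  fixes \<phi> \<gamma> :: "nat \<Rightarrow> int" and M r R :: int and K :: "int set"
  assumes M: "M > 0" and R: "R \<ge> 0"
    and lip: "\<And>i j. i \<le> j \<Longrightarrow> \<bar>\<phi> i - \<phi> j\<bar> \<le> int j - int i"
    and res: "\<And>k. k \<in> K \<Longrightarrow> k mod M = r"
    and cov: "\<And>k. k \<in> K \<Longrightarrow> \<exists>\<tau>\<in>{a..a + n}. \<bar>\<phi> \<tau> - k\<bar> \<le> R \<and> \<bar>\<gamma> \<tau>\<bar> \<le> R"
    and new: "\<And>k. k \<in> K \<Longrightarrow> \<not> (\<bar>\<phi> a - k\<bar> \<le> R \<and> \<bar>\<gamma> a\<bar> \<le> R)"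
  shows "M * int (card K) \<le>
    int n + 2 * M + 2 * (if \<exists>\<tau>\<in>{a..a + n}. \<bar>\<gamma> \<tau>\<bar> > R then R else 0)"
proof -
  define lo where "lo = Min (\<phi> ` {a..a + n})"
  define hi where "hi = Max (\<phi> ` {a..a + n})"
  have mem: "lo \<le> \<phi> \<tau>" "\<phi> \<tau> \<le> hi" if "\<tau> \<in> {a..a + n}" for \<tau>
    using that unfolding lo_def hi_def by auto
  have "lo \<in> \<phi> ` {a..a + n}" "hi \<in> \<phi> ` {a..a + n}"
    unfolding lo_def hi_def by (auto intro!: Min_in Max_in)
  then obtain i j where ij: "i \<in> {a..a + n}" "j \<in> {a..a + n}" "lo = \<phi> i" "hi = \<phi> j"
    by auto
  have width: "hi - lo \<le> int n"
  proof (cases "i \<le> j")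
    case True
    then show ?thesis using lip[OF True] ij by auto
  next
    case False
    then show ?thesis using lip[of j i] ij by auto
  qed
  have range: "lo - R \<le> k \<and> k \<le> hi + R" if "k \<in> K" for k
    using cov[OF that] mem by fastforce
  show ?thesis
  proof (cases "\<exists>\<tau>\<in>{a..a + n}. \<bar>\<gamma> \<tau>\<bar> > R")
    case True
    have "K \<subseteq> {k \<in> {lo - R..hi + R}. k mod M = r}" using res range by auto
    then have "card K \<le> card {k \<in> {lo - R..hi + R}. k mod M = r}"
      by (intro card_mono finite_interval_filter)
    then have "M * int (card K) \<le> M * int (card {k \<in> {lo - R..hi + R}. k mod M = r})"
      using M by simp
    also have "\<dots> \<le> (hi + R) - (lo - R) + M"
      using mem[of a] M R by (intro card_residue_class) auto
    finally show ?thesis using True width M by simp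
  next
    case False
    let ?A = "{k \<in> {lo - R..\<phi> a - R - 1}. k mod M = r}"
    let ?B = "{k \<in> {\<phi> a + R + 1..hi + R}. k mod M = r}"
    have not_far: "\<bar>\<gamma> \<tau>\<bar> \<le> R" if "\<tau> \<in> {a..a + n}" for \<tau> using False that by (meson not_le)
    have "\<bar>\<phi> a - k\<bar> > R" if "k \<in> K" for k
      using new[OF that] not_far[of a] by auto
    then have "K \<subseteq> ?A \<union> ?B" using res range by fastforce
    then have "card K \<le> card (?A \<union> ?B)"
      by (intro card_mono finite_UnI finite_interval_filter)
    also have "\<dots> \<le> card ?A + card ?B" by (rule card_Un_le)
    finally have "M * int (card K) \<le> M * int (card ?A + card ?B)"
      using M by (intro mult_left_mono) linarith+
    also have "\<dots> = M * int (card ?A) + M * int (card ?B)" by (simp add: algebra_simps)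
    also have "\<dots> \<le> ((\<phi> a - R - 1) - (lo - R) + M) + ((hi + R) - (\<phi> a + R + 1) + M)"
      using mem[of a] M by (intro add_mono card_residue_class) auto
    finally show ?thesis using False width by simp
  qed
qed

section \<open>The fence and its levels\<close>

text \<open>
  \<open>Q\<close> bounds all the radii \<open>B * 2 ^ r\<close>. The squares of a side that are less than \<open>L\<close> away from
  a corner are put on the top level; \<open>4 * Q < L\<close> makes the Angel too slow to deal with two
  sides in one period. The last condition says that the top level can be deleted in \<open>H - Q\<close> turns:
  each of the four sides has at most \<open>2 * L\<close> such squares near its ends and \<open>(2 * H + M) / M\<close> in
  each of the five residue classes.
\<close>

locale fencing =
  fixes s m :: nat and M B Q L H :: int
  assumes M: "M = int m + 5"
    and B: "B > 2 * int m * M + 5 * int s"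
    and Q: "Q = B * 2 ^ m"
    and L: "4 * Q < L"
    and H: "0 < H" "M * (H - Q) > 4 * (2 * L * M + 5 * (2 * H + M))"
begin

lemma M_pos: "M > 0" using M by simp

lemma B_pos: "B > 0" "B > int s" "B > 2 * int m * M"
proof -
  have "2 * int m * M \<ge> 0" using M by simp
  then show "B > 0" "B > int s" "B > 2 * int m * M" using B by linarith+
qed

lemma B_le_Q: "B \<le> Q" unfolding Q using B_pos by simp

lemma radius_le_Q: "r \<le> m \<Longrightarrow> B * 2 ^ r \<le> Q"
  unfolding Q using B_pos by (intro mult_left_mono power_increasing) auto

lemma radius_ge_B: "B \<le> B * 2 ^ r"
  using B_pos by simp

lemma L_less_H: "L < H" "Q < H"
proof -
  have Lp: "L > 0" using L B_le_Q B_pos by linarith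
  have "M * (H - Q) > M * (8 * L)"
    using H M_pos by (simp add: algebra_simps)
  then have "H - Q > 8 * L" using M_pos by (metis mult_less_cancel_left_pos)
  then show "L < H" "Q < H" using Lp B_le_Q B_pos by linarith+
qed

definition box :: "square set" where
  "box = {-H..H} \<times> {-H..H}"

definition fence :: "square set" where
  "fence = {u. king_dist (0, 0) u = H}"

lemma finite_box: "finite box" unfolding box_def by simp

lemma fence_subset_box: "fence \<subseteq> box"
  unfolding fence_def box_def king_dist_def by auto

definition coord_level :: "int \<Rightarrow> nat" where
  "coord_level k = (if \<bar>k\<bar> \<le> H - L then min m (nat (k mod M)) else m)"

text \<open>
  On a horizontal side the position is the first coordinate, on a vertical side the second one. The
  four corner squares get the top level under either reading.
\<close>

definition level :: "square \<Rightarrow> nat" where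
  "level u = coord_level (if \<bar>snd u\<bar> = H then fst u else snd u)"

lemma level_le: "level u \<le> m" unfolding level_def coord_level_def by simp

text \<open>
  A side is represented by the pair of functions giving the coordinate along it and the signed
  distance from it, so that the four sides can be treated alike.
\<close>

definition sides :: "((square \<Rightarrow> int) \<times> (square \<Rightarrow> int)) set" where
  "sides = {(fst, \<lambda>z. snd z - H), (fst, \<lambda>z. snd z + H),
            (snd, \<lambda>z. fst z - H), (snd, \<lambda>z. fst z + H)}"

lemma king_dist_side:
  assumes "(f, g) \<in> sides"
  shows "king_dist z u = max \<bar>f z - f u\<bar> \<bar>g z - g u\<bar>"
  using assms unfolding sides_def king_dist_def by auto

text \<open>
  Below the top level, squares of different sides are at distance at least \<open>L\<close>, because at least one of
  the two is that far from the other's side.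
\<close>

lemma close_squares_same_side:
  assumes "X \<subseteq> fence" and "\<And>v. v \<in> X \<Longrightarrow> level v < m" and "u \<in> X"
    and "\<And>v. v \<in> X \<Longrightarrow> king_dist u v < L"
  shows "\<exists>(f, g)\<in>sides. \<forall>v\<in>X. g v = 0 \<and> f v mod M = int (level v)"
proof -
  have Lp: "L > 0" using L B_le_Q B_pos by linarith
  have lv: "(\<bar>snd v\<bar> = H \<and> \<bar>fst v\<bar> \<le> H - L \<and> fst v mod M = int (level v)) \<or>
     (\<bar>fst v\<bar> = H \<and> \<bar>snd v\<bar> \<le> H - L \<and> snd v mod M = int (level v))" if "v \<in> X" for v
  proof (cases "\<bar>snd v\<bar> = H")
    case True
    then have "coord_level (fst v) < m" "level v = coord_level (fst v)"
      using assms(2)[OF that] unfolding level_def by auto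
    then show ?thesis using True M_pos unfolding coord_level_def by (auto split: if_splits)
  next
    case False
    then have "coord_level (snd v) < m" "level v = coord_level (snd v)"
      using assms(2)[OF that] unfolding level_def by auto
    moreover have "\<bar>fst v\<bar> = H"
      using that assms(1) False unfolding fence_def king_dist_def by auto
    ultimately show ?thesis using M_pos unfolding coord_level_def by (auto split: if_splits)
  qed
  have near: "\<bar>fst u - fst v\<bar> < L \<and> \<bar>snd u - snd v\<bar> < L" if "v \<in> X" for v
    using assms(4)[OF that] unfolding king_dist_def by auto
  consider "snd u = H" "\<bar>fst u\<bar> \<le> H - L" | "snd u = -H" "\<bar>fst u\<bar> \<le> H - L"
    | "fst u = H" "\<bar>snd u\<bar> \<le> H - L" | "fst u = -H" "\<bar>snd u\<bar> \<le> H - L"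
    using lv[OF assms(3)] by linarith
  then show ?thesis
  proof cases
    case 1
    have "\<forall>v\<in>X. snd v - H = 0 \<and> fst v mod M = int (level v)"
      using lv near 1 L_less_H Lp by (smt (verit))
    then show ?thesis unfolding sides_def by auto
  next
    case 2
    have "\<forall>v\<in>X. snd v + H = 0 \<and> fst v mod M = int (level v)"
      using lv near 2 L_less_H Lp by (smt (verit))
    then show ?thesis unfolding sides_def by auto
  next
    case 3
    have "\<forall>v\<in>X. fst v - H = 0 \<and> snd v mod M = int (level v)"
      using lv near 3 L_less_H Lp by (smt (verit))
    then show ?thesis unfolding sides_def by auto
  next
    case 4
    have "\<forall>v\<in>X. fst v + H = 0 \<and> snd v mod M = int (level v)"
      using lv near 4 L_less_H Lp by (smt (verit))
    then show ?thesis unfolding sides_def by auto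
  qed
qed

lemma card_top_level: "int (card {u \<in> fence. level u = m}) < H - Q"
proof -
  define E where "E = {k \<in> {-H..H}. coord_level k = m}"
  have Lp: "L > 0" using L B_le_Q B_pos by linarith
  have finE: "finite E" unfolding E_def by (rule finite_interval_filter)
  let ?res = "\<lambda>r. {k \<in> {-H..H}. k mod M = r}"
  have "E \<subseteq> ({-H..-H + L - 1} \<union> {H - L + 1..H}) \<union> (\<Union>r\<in>{int m..int m + 4}. ?res r)"
  proof
    fix k assume k: "k \<in> E"
    show "k \<in> ({-H..-H + L - 1} \<union> {H - L + 1..H}) \<union> (\<Union>r\<in>{int m..int m + 4}. ?res r)"
    proof (cases "\<bar>k\<bar> \<le> H - L")
      case True
      then have "nat (k mod M) \<ge> m" using k unfolding E_def coord_level_def by auto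
      moreover have "k mod M < int m + 5" "k mod M \<ge> 0" using M_pos M by auto
      ultimately show ?thesis using k unfolding E_def by auto
    next
      case False
      then show ?thesis using k unfolding E_def by auto
    qed
  qed
  then have "card E \<le> card (({-H..-H + L - 1} \<union> {H - L + 1..H}) \<union> (\<Union>r\<in>{int m..int m + 4}. ?res r))"
    by (intro card_mono finite_UnI finite_UN_I finite_interval_filter) simp_all
  also have "\<dots> \<le> card ({-H..-H + L - 1} \<union> {H - L + 1..H}) + card (\<Union>r\<in>{int m..int m + 4}. ?res r)"
    by (rule card_Un_le)
  also have "\<dots> \<le> (card {-H..-H + L - 1} + card {H - L + 1..H}) + (\<Sum>r\<in>{int m..int m + 4}. card (?res r))"
    by (intro add_mono card_Un_le card_UN_le) auto
  finally have "int (card E) \<le> 2 * L + (\<Sum>r\<in>{int m..int m + 4}. int (card (?res r)))"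
    using Lp by (simp flip: of_nat_sum)
  then have "M * int (card E) \<le> M * (2 * L + (\<Sum>r\<in>{int m..int m + 4}. int (card (?res r))))"
    using M_pos by (intro mult_left_mono) auto
  also have "\<dots> = 2 * L * M + (\<Sum>r\<in>{int m..int m + 4}. M * int (card (?res r)))"
    by (simp add: algebra_simps sum_distrib_left)
  also have "(\<Sum>r\<in>{int m..int m + 4}. M * int (card (?res r))) \<le>
      (\<Sum>r\<in>{int m..int m + 4}. H - (- H) + M)"
    using M_pos H by (intro sum_mono card_residue_class) auto
  also have "\<dots> = 5 * (2 * H + M)" by simp
  finally have cE: "M * int (card E) \<le> 2 * L * M + 5 * (2 * H + M)" by simp
  have "{u \<in> fence. level u = m} \<subseteq>
    ((\<lambda>k. (k, H)) ` E \<union> (\<lambda>k. (k, -H)) ` E) \<union> ((\<lambda>k. (H, k)) ` E \<union> (\<lambda>k. (-H, k)) ` E)"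
  proof
    fix u assume u: "u \<in> {u \<in> fence. level u = m}"
    obtain x y where xy: "u = (x, y)" by (cases u)
    have m: "max \<bar>x\<bar> \<bar>y\<bar> = H" using u unfolding fence_def king_dist_def xy by simp
    show "u \<in> ((\<lambda>k. (k, H)) ` E \<union> (\<lambda>k. (k, -H)) ` E) \<union> ((\<lambda>k. (H, k)) ` E \<union> (\<lambda>k. (-H, k)) ` E)"
    proof (cases "\<bar>y\<bar> = H")
      case True
      then have "x \<in> E" using u m unfolding E_def level_def xy by auto
      then show ?thesis using True unfolding xy by (auto simp: abs_if split: if_splits)
    next
      case False
      then have "y \<in> E" "\<bar>x\<bar> = H" using u m unfolding E_def level_def xy by auto
      then show ?thesis unfolding xy by (auto simp: abs_if split: if_splits)
    qed
  qed
  then have "card {u \<in> fence. level u = m} \<le>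
    card (((\<lambda>k. (k, H)) ` E \<union> (\<lambda>k. (k, -H)) ` E) \<union> ((\<lambda>k. (H, k)) ` E \<union> (\<lambda>k. (-H, k)) ` E))"
    using finE by (intro card_mono) auto
  also have "\<dots> \<le> (card ((\<lambda>k. (k, H)) ` E) + card ((\<lambda>k. (k, -H)) ` E)) +
      (card ((\<lambda>k. (H, k)) ` E) + card ((\<lambda>k. (-H, k)) ` E))"
    by (intro order_trans[OF card_Un_le] add_mono card_Un_le)
  also have "\<dots> \<le> (card E + card E) + (card E + card E)"
    using finE by (intro add_mono card_image_le)
  finally have "M * int (card {u \<in> fence. level u = m}) \<le> M * (4 * int (card E))"
    using M_pos by (intro mult_left_mono) auto
  also have "\<dots> \<le> 4 * (2 * L * M + 5 * (2 * H + M))" using cE by simp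
  also have "\<dots> < M * (H - Q)" using H by simp
  finally show ?thesis using M_pos by simp
qed

section \<open>The Devil's strategy\<close>

definition pending :: "square \<Rightarrow> square set \<Rightarrow> square set" where
  "pending z D = {u \<in> fence - D. level u = m \<or> king_dist z u \<le> B * 2 ^ level u}"

text \<open>
  The last case, in which the whole box is already gone, keeps the function a legal strategy for every
  argument.
\<close>

definition devil_choice :: "square \<Rightarrow> square set \<Rightarrow> square" where
  "devil_choice z D =
     (if pending z D \<noteq> {} then ARG_MAX level u. u \<in> pending z D
      else if box - D \<noteq> {} then SOME u. u \<in> box - D
      else SOME u. u \<notin> D)"

definition devil :: strategy where
  "devil revealed deleted = devil_choice (last revealed) (set deleted)"

lemma devil_choice_pending:
  assumes "v \<in> pending z D"
  shows "devil_choice z D \<in> pending z D" and "level v \<le> level (devil_choice z D)"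
proof -
  have eq: "devil_choice z D = (ARG_MAX level u. u \<in> pending z D)"
    using assms unfolding devil_choice_def by auto
  have bound: "\<forall>u. u \<in> pending z D \<longrightarrow> level u < Suc m" using level_le by (simp add: le_imp_less_Suc)
  show "devil_choice z D \<in> pending z D" unfolding eq
    using arg_max_natI[where P = "\<lambda>u. u \<in> pending z D", OF assms bound] .
  show "level v \<le> level (devil_choice z D)" unfolding eq
    using arg_max_nat_le[where P = "\<lambda>u. u \<in> pending z D", OF assms bound] .
qed

lemma devil_choice_box:
  assumes "\<not> box \<subseteq> D"
  shows "devil_choice z D \<in> box - D"
proof (cases "pending z D = {}")
  case True
  then have "devil_choice z D = (SOME u. u \<in> box - D)"
    using assms unfolding devil_choice_def by auto
  moreover have "\<exists>u. u \<in> box - D" using assms by auto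
  ultimately show ?thesis by (metis someI_ex)
next
  case False
  then show ?thesis
    using devil_choice_pending(1) fence_subset_box unfolding pending_def by blast
qed

lemma devil_choice_fresh:
  assumes "finite D"
  shows "devil_choice z D \<notin> D"
proof (cases "box \<subseteq> D")
  case True
  then have "pending z D = {}" using fence_subset_box unfolding pending_def by auto
  then have "devil_choice z D = (SOME u. u \<notin> D)" using True unfolding devil_choice_def by auto
  moreover have "\<exists>u. u \<notin> D" using assms
    by (metis ex_new_if_finite finite_prod infinite_UNIV_int)
  ultimately show ?thesis by (metis someI_ex)
next
  case False
  then show ?thesis using devil_choice_box by auto
qed

lemma devil_strategy_devil: "devil_strategy devil"
  unfolding devil_strategy_def devil_def using devil_choice_fresh by simp

section \<open>Playing against a king path\<close>

context
  fixes p :: "nat \<Rightarrow> square"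
  assumes start: "p 0 = (0, 0)"
    and king: "\<And>n. king_move (p n) (p (Suc n))"
begin

definition deleted :: "nat \<Rightarrow> square set" where
  "deleted n = set (deletions devil p n)"

definition target :: "nat \<Rightarrow> square" where
  "target n = devil_choice (p n) (deleted n)"

lemma deleted_0: "deleted 0 = {}" unfolding deleted_def by simp

lemma deleted_Suc: "deleted (Suc n) = insert (target n) (deleted n)"
  unfolding deleted_def target_def devil_def by simp

lemma deleted_mono: "i \<le> j \<Longrightarrow> deleted i \<subseteq> deleted j"
  by (induction rule: dec_induct) (auto simp: deleted_Suc)

lemma target_fresh: "target n \<notin> deleted n"
  unfolding target_def using devil_choice_fresh by (simp add: deleted_def)

lemma target_deleted: "i < j \<Longrightarrow> target i \<in> deleted j"
  using deleted_mono[of "Suc i" j] by (auto simp: deleted_Suc)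

lemma inj_target: "inj target"
proof (rule injI)
  fix i j assume "target i = target j"
  then show "i = j"
    using target_deleted[of i j] target_deleted[of j i] target_fresh[of i] target_fresh[of j]
    by (cases i j rule: linorder_cases) auto
qed

text \<open>
  This is the busy-period argument. If \<open>u\<close> were late at time \<open>t\<close>, let \<open>t0\<close> be the beginning of the
  period up to \<open>t\<close> in which the Devil is always occupied with squares at least as important as \<open>u\<close>.
  If \<open>t0 = 0\<close>, the first \<open>H - Q\<close> turns were all spent on the top level, which is too small for that.
  Otherwise nothing of this importance was pending at time \<open>a = t0 - 1\<close>. So the squares deleted
  since are not on the top level and were out of reach at time \<open>a\<close>, which allows them to be counted.
  The count needs them to be on one side, hence a period of at most \<open>Q\<close> turns; it is first applied to
  the first \<open>Q\<close> turns to show that the period is no longer than that.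
\<close>

lemma fence_deleted_in_time:
  assumes u: "u \<in> fence" and near: "king_dist (p t) u \<le> int s"
  shows "u \<in> deleted t"
proof (rule ccontr)
  assume nu: "u \<notin> deleted t"
  define busy where "busy \<tau> \<longleftrightarrow> (\<exists>v\<in>pending (p \<tau>) (deleted \<tau>). level u \<le> level v)" for \<tau>
  have path: "king_dist (p i) (p j) \<le> int j - int i" if "i \<le> j" for i j
    using king that by (rule king_path_dist_le)
  have dist_u: "king_dist (p \<tau>) u \<le> int s + (int t - int \<tau>)" if "\<tau> \<le> t" for \<tau>
    using path[OF that] near king_dist_triangle[of "p \<tau>" u "p t"] by linarith
  have busy_near: "busy \<tau>" if "\<tau> \<le> t" "int t - int \<tau> \<le> B - int s" for \<tau>
  proof -
    have "king_dist (p \<tau>) u \<le> B * 2 ^ level u"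
      using dist_u[OF that(1)] that(2) radius_ge_B[of "level u"] by linarith
    then have "u \<in> pending (p \<tau>) (deleted \<tau>)"
      using u nu deleted_mono[OF that(1)] unfolding pending_def by auto
    then show ?thesis unfolding busy_def by auto
  qed
  define t0 where "t0 = (LEAST k. \<forall>\<tau>. k \<le> \<tau> \<and> \<tau> < t \<longrightarrow> busy \<tau>)"
  have t0: "\<forall>\<tau>. t0 \<le> \<tau> \<and> \<tau> < t \<longrightarrow> busy \<tau>"
    unfolding t0_def by (rule LeastI[of _ t]) auto
  have t0_least: "t0 \<le> k" if "\<forall>\<tau>. k \<le> \<tau> \<and> \<tau> < t \<longrightarrow> busy \<tau>" for k
    unfolding t0_def using that by (rule Least_le)
  have t0_le: "t0 \<le> t" by (rule t0_least) auto
  have target: "target \<tau> \<in> pending (p \<tau>) (deleted \<tau>)" "level u \<le> level (target \<tau>)"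
    if \<tau>: "t0 \<le> \<tau>" "\<tau> < t" for \<tau>
  proof -
    have "busy \<tau>" using t0 \<tau> by simp
    then obtain v where "v \<in> pending (p \<tau>) (deleted \<tau>)" "level u \<le> level v"
      unfolding busy_def by auto
    then show "target \<tau> \<in> pending (p \<tau>) (deleted \<tau>)" "level u \<le> level (target \<tau>)"
      unfolding target_def using devil_choice_pending[of v "p \<tau>" "deleted \<tau>"] by auto
  qed
  have "t0 \<noteq> 0"
  proof
    assume 0: "t0 = 0"
    \<comment> \<open>During the first \<open>H - Q\<close> turns the Angel is too far away for any lower level to be urgent.\<close>
    have far: "H - int \<tau> \<le> king_dist (p \<tau>) v" if "v \<in> fence" for \<tau> v
      using that path[of 0 \<tau>] king_dist_triangle[of "p 0" v "p \<tau>"]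
      unfolding fence_def start by simp
    define n where "n = nat (H - Q)"
    have n: "int n = H - Q" unfolding n_def using L_less_H by simp
    have "n \<le> t" using far[OF u, of t] near n B_le_Q B_pos by linarith
    have "target ` {..<n} \<subseteq> {v \<in> fence. level v = m}"
    proof
      fix v assume "v \<in> target ` {..<n}"
      then obtain \<tau> where \<tau>: "\<tau> < n" "v = target \<tau>" by auto
      then have v: "v \<in> pending (p \<tau>) (deleted \<tau>)" using target[of \<tau>] 0 \<open>n \<le> t\<close> by auto
      then have "H - int \<tau> \<le> king_dist (p \<tau>) v" using far unfolding pending_def by auto
      then have "\<not> king_dist (p \<tau>) v \<le> B * 2 ^ level v"
        using radius_le_Q[OF level_le, of v] \<tau>(1) n by linarith
      then show "v \<in> {v \<in> fence. level v = m}" using v unfolding pending_def by auto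
    qed
    then have "card (target ` {..<n}) \<le> card {v \<in> fence. level v = m}"
      using finite_subset[OF fence_subset_box finite_box] by (intro card_mono) auto
    moreover have "card (target ` {..<n}) = n"
      using card_image[OF inj_on_subset[OF inj_target subset_UNIV]] by simp
    ultimately show False using card_top_level n by linarith
  qed
  then obtain a where a: "t0 = Suc a" by (cases t0) auto
  have "\<not> busy a"
  proof
    assume "busy a"
    then have "\<forall>\<tau>. a \<le> \<tau> \<and> \<tau> < t \<longrightarrow> busy \<tau>" using t0 a by (metis Suc_leI le_neq_implies_less)
    then show False using t0_least[of a] a by simp
  qed
  have quiet: "level v < m \<and> king_dist (p a) v > B * 2 ^ level v"
    if "v \<in> fence" "v \<notin> deleted a" "level u \<le> level v" for v
    using \<open>\<not> busy a\<close> that level_le[of v] unfolding busy_def pending_def by fastforce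
  have long: "int t - int t0 \<ge> B - int s"
    using busy_near[of a] \<open>\<not> busy a\<close> t0_le a by linarith
  \<comment> \<open>The number of turns is the number of squares deleted, counted level by level. If the turns
    considered reach up to \<open>t\<close>, then \<open>u\<close> is near too, so the side in question is the side of \<open>u\<close>.\<close>
  have count: "\<exists>f g. (f, g) \<in> sides \<and> (n = t - t0 \<longrightarrow> g u = 0) \<and>
      M * int n \<le> int m * (int n + 2 * M) +
        2 * (\<Sum>r<m. if \<exists>\<tau>\<in>{a..a + n}. \<bar>g (p \<tau>)\<bar> > B * 2 ^ r then B * 2 ^ r else 0)"
    if n: "0 < n" "t0 + n \<le> t" "int n \<le> Q" for n
  proof -
    define X where "X = target ` {t0..<t0 + n}"
    define Y where "Y = (if n = t - t0 then insert u X else X)"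
    have X: "v \<in> fence \<and> v \<notin> deleted a \<and> level u \<le> level v \<and>
        (\<exists>\<tau>\<in>{a..a + n}. king_dist (p \<tau>) v \<le> B * 2 ^ level v)" if "v \<in> X" for v
    proof -
      from that obtain \<tau> where \<tau>: "t0 \<le> \<tau>" "\<tau> < t0 + n" "v = target \<tau>" unfolding X_def by auto
      have pend: "v \<in> pending (p \<tau>) (deleted \<tau>)" "level u \<le> level v" using target[of \<tau>] \<tau> n by auto
      have "v \<notin> deleted a" using pend deleted_mono[of a \<tau>] \<tau> a unfolding pending_def by auto
      moreover from this have "level v < m" using quiet[of v] pend unfolding pending_def by auto
      moreover have "\<tau> \<in> {a..a + n}" using \<tau> a by auto
      ultimately show ?thesis using pend unfolding pending_def by auto
    qed
    have near_a: "v \<in> fence \<and> level v < m \<and> king_dist (p a) v \<le> 2 * Q" if "v \<in> Y" for v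
    proof (cases "v \<in> X")
      case True
      note v = X[OF True]
      then obtain \<tau> where \<tau>: "\<tau> \<in> {a..a + n}" "king_dist (p \<tau>) v \<le> B * 2 ^ level v" by auto
      then have "king_dist (p a) v \<le> int n + B * 2 ^ level v"
        using path[of a \<tau>] king_dist_triangle[of "p a" v "p \<tau>"] by auto
      then show ?thesis using v quiet[of v] n(3) radius_le_Q[OF level_le, of v] by auto
    next
      case False
      then have v: "v = u" "n = t - t0" using that unfolding Y_def by (auto split: if_splits)
      have "u \<notin> deleted a" using nu deleted_mono[of a t] t0_le a by auto
      moreover have "king_dist (p a) u \<le> 2 * Q"
        using dist_u[of a] t0_le a v n(3) B_le_Q B_pos by simp
      ultimately show ?thesis using v u quiet[of u] by auto
    qed
    have "target t0 \<in> X" unfolding X_def using n by auto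
    then have x0: "target t0 \<in> Y" unfolding Y_def by auto
    have "king_dist (target t0) v < L" if "v \<in> Y" for v
      using near_a[OF that] near_a[OF x0] L king_dist_triangle[of "target t0" v "p a"]
        king_dist_sym[of "target t0" "p a"] by linarith
    then obtain f g where fg: "(f, g) \<in> sides" "\<And>v. v \<in> Y \<Longrightarrow> g v = 0 \<and> f v mod M = int (level v)"
      using close_squares_same_side[of Y "target t0"] near_a x0 by fast
    have XY: "X \<subseteq> Y" unfolding Y_def by auto
    have dist_side: "king_dist z v = max \<bar>f z - f v\<bar> \<bar>g z\<bar>" if "v \<in> X" for z v
      using king_dist_side[OF fg(1), of z v] fg(2)[of v] that XY by auto
    have inj: "inj_on f X"
    proof (rule inj_onI)
      fix v w assume vw: "v \<in> X" "w \<in> X" "f v = f w"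
      then have "king_dist v w = 0"
        using dist_side[of w v] fg(2)[of v] XY by auto
      then show "v = w" unfolding king_dist_def by (simp add: prod_eq_iff max_def split: if_splits)
    qed
    define Xr where "Xr r = {v \<in> X. level v = r}" for r
    have finX: "finite X" unfolding X_def by simp
    have each: "M * int (card (Xr r)) \<le> int n + 2 * M +
        2 * (if \<exists>\<tau>\<in>{a..a + n}. \<bar>g (p \<tau>)\<bar> > B * 2 ^ r then B * 2 ^ r else 0)" for r
    proof -
      have "card (f ` Xr r) = card (Xr r)"
        using inj unfolding Xr_def by (intro card_image) (auto intro: inj_on_subset)
      moreover have "M * int (card (f ` Xr r)) \<le> int n + 2 * M +
        2 * (if \<exists>\<tau>\<in>{a..a + n}. \<bar>g (p \<tau>)\<bar> > B * 2 ^ r then B * 2 ^ r else 0)"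
      proof (rule card_newly_covered[where \<phi> = "\<lambda>\<tau>. f (p \<tau>)" and \<gamma> = "\<lambda>\<tau>. g (p \<tau>)" and r = "int r"])
        show "M > 0" by (rule M_pos)
        show "0 \<le> B * 2 ^ r" using B_pos by simp
        show "\<bar>f (p i) - f (p j)\<bar> \<le> int j - int i" if "i \<le> j" for i j
          using path[OF that] king_dist_side[OF fg(1), of "p i" "p j"] by auto
        fix k assume "k \<in> f ` Xr r"
        then obtain v where v: "k = f v" "v \<in> X" "level v = r" unfolding Xr_def by auto
        show "k mod M = int r" using fg(2)[of v] v XY by auto
        show "\<exists>\<tau>\<in>{a..a + n}. \<bar>f (p \<tau>) - k\<bar> \<le> B * 2 ^ r \<and> \<bar>g (p \<tau>)\<bar> \<le> B * 2 ^ r"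
          using X[OF v(2)] dist_side[OF v(2)] v by auto
        show "\<not> (\<bar>f (p a) - k\<bar> \<le> B * 2 ^ r \<and> \<bar>g (p a)\<bar> \<le> B * 2 ^ r)"
          using quiet[of v] X[OF v(2)] dist_side[OF v(2)] v by auto
      qed
      ultimately show ?thesis by simp
    qed
    have "X = (\<Union>r<m. Xr r)" using near_a XY unfolding Xr_def by auto
    then have "card X \<le> (\<Sum>r<m. card (Xr r))" by (metis card_UN_le finite_lessThan)
    moreover have "card X = n"
      unfolding X_def using card_image[OF inj_on_subset[OF inj_target subset_UNIV]] by simp
    ultimately have "M * int n \<le> M * int (\<Sum>r<m. card (Xr r))"
      using M_pos by (intro mult_left_mono) linarith+
    also have "\<dots> = (\<Sum>r<m. M * int (card (Xr r)))" by (simp add: sum_distrib_left)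
    also have "\<dots> \<le> (\<Sum>r<m. int n + 2 * M +
        2 * (if \<exists>\<tau>\<in>{a..a + n}. \<bar>g (p \<tau>)\<bar> > B * 2 ^ r then B * 2 ^ r else 0))"
      by (intro sum_mono each)
    also have "\<dots> = int m * (int n + 2 * M) +
        2 * (\<Sum>r<m. if \<exists>\<tau>\<in>{a..a + n}. \<bar>g (p \<tau>)\<bar> > B * 2 ^ r then B * 2 ^ r else 0)"
      by (simp add: sum.distrib sum_distrib_left)
    finally have bound: "M * int n \<le> int m * (int n + 2 * M) +
        2 * (\<Sum>r<m. if \<exists>\<tau>\<in>{a..a + n}. \<bar>g (p \<tau>)\<bar> > B * 2 ^ r then B * 2 ^ r else 0)" .
    have "g u = 0" if "n = t - t0" using fg(2)[of u] that unfolding Y_def by simp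
    then show ?thesis using fg(1) bound by blast
  qed
  show False
  proof (cases "int (t - t0) \<le> Q")
    case False
    \<comment> \<open>Bounding the sum of all radii by \<open>Q\<close> suffices here: \<open>5 * Q \<le> 2 * m * M + 2 * Q\<close> is absurd.\<close>
    define n where "n = nat Q"
    have n: "int n = Q" unfolding n_def using B_le_Q B_pos by simp
    then have "0 < n" "t0 + n \<le> t" using False B_le_Q B_pos t0_le by linarith+
    obtain g where "M * int n \<le> int m * (int n + 2 * M) +
        2 * (\<Sum>r<m. if \<exists>\<tau>\<in>{a..a + n}. \<bar>g (p \<tau>)\<bar> > B * 2 ^ r then B * 2 ^ r else 0)"
      using count[of n] n \<open>0 < n\<close> \<open>t0 + n \<le> t\<close> by auto
    moreover have "(\<Sum>r<m. if \<exists>\<tau>\<in>{a..a + n}. \<bar>g (p \<tau>)\<bar> > B * 2 ^ r then B * 2 ^ r else 0) \<le> Q"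
      unfolding Q using B_pos by (intro geometric_sum_below(2)[where N = 0]) auto
    ultimately have "M * Q \<le> int m * (Q + 2 * M) + 2 * Q" unfolding n by linarith
    then show False using M B_le_Q B_pos by (simp add: algebra_simps)
  next
    case True
    define n where "n = t - t0"
    have n: "int n \<ge> B - int s" "t = Suc (a + n)" using long t0_le a unfolding n_def by auto
    then obtain f g where fg: "(f, g) \<in> sides" "g u = 0" "M * int n \<le> int m * (int n + 2 * M) +
        2 * (\<Sum>r<m. if \<exists>\<tau>\<in>{a..a + n}. \<bar>g (p \<tau>)\<bar> > B * 2 ^ r then B * 2 ^ r else 0)"
      using count[of n] True B_pos a unfolding n_def by auto
    \<comment> \<open>The Angel ends up within \<open>s\<close> of the side, so it was never farther away than the time left.\<close>
    have "(\<Sum>r<m. if \<exists>\<tau>\<in>{a..a + n}. \<bar>g (p \<tau>)\<bar> > B * 2 ^ r then B * 2 ^ r else 0) \<le>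
        (\<Sum>r<m. if B * 2 ^ r \<le> int s + int n then B * 2 ^ r else 0)"
    proof (intro sum_mono)
      fix r
      have "B * 2 ^ r \<le> int s + int n" if \<tau>: "\<tau> \<in> {a..a + n}" "\<bar>g (p \<tau>)\<bar> > B * 2 ^ r" for \<tau>
      proof -
        have "\<bar>g (p \<tau>)\<bar> \<le> int s + (int t - int \<tau>)"
          using dist_u[of \<tau>] \<tau> n king_dist_side[OF fg(1), of "p \<tau>" u] fg(2) by auto
        then show ?thesis using \<tau> n by auto
      qed
      then show "(if \<exists>\<tau>\<in>{a..a + n}. \<bar>g (p \<tau>)\<bar> > B * 2 ^ r then B * 2 ^ r else 0) \<le>
          (if B * 2 ^ r \<le> int s + int n then B * 2 ^ r else 0)"
        using B_pos by auto
    qed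
    also have "\<dots> \<le> 2 * (int s + int n)"
      using B_pos by (intro geometric_sum_below(1)) auto
    finally have "M * int n \<le> int m * (int n + 2 * M) + 4 * (int s + int n)"
      using fg(3) by linarith
    then have "int n \<le> 2 * int m * M + 4 * int s" using M by (simp add: algebra_simps)
    then show False using n B by linarith
  qed
qed

lemma box_deleted_eventually: "box \<subseteq> deleted (card box)"
proof (rule ccontr)
  assume "\<not> box \<subseteq> deleted (card box)"
  then obtain u where u: "u \<in> box" "u \<notin> deleted (card box)" by auto
  have "target ` {..<card box} \<subseteq> box - {u}"
  proof
    fix v assume "v \<in> target ` {..<card box}"
    then obtain n where n: "n < card box" "v = target n" by auto
    then have "u \<notin> deleted n" "v \<noteq> u"
      using u deleted_mono[of n "card box"] target_deleted[of n "card box"] by auto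
    then show "v \<in> box - {u}"
      using devil_choice_box[of "deleted n" "p n"] u n unfolding target_def by auto
  qed
  then have "card (target ` {..<card box}) \<le> card (box - {u})"
    using finite_box by (intro card_mono) auto
  moreover have "card (target ` {..<card box}) = card box"
    using card_image[OF inj_on_subset[OF inj_target subset_UNIV]] by simp
  moreover have "card (box - {u}) < card box" using u finite_box by (meson card_Diff1_less)
  ultimately show False by simp
qed

text \<open>
  The deletions that restrict move number \<open>n + 1\<close> are those made with knowledge of the positions
  before time \<open>n + 1 - s\<close>. The position at this time is within distance \<open>s\<close> of the square moved to, so
  that square has been deleted if it is on the fence.
\<close>

lemma path_blocked: "\<exists>n. p (Suc n) \<in> set (deletions devil p (Suc n - s))"
  unfolding deleted_def[symmetric]
proof (rule ccontr)
  assume free: "\<nexists>n. p (Suc n) \<in> deleted (Suc n - s)"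
  have off: "p n \<notin> fence" for n
  proof (cases n)
    case 0
    then show ?thesis using start H(1) by (simp add: fence_def king_dist_def)
  next
    case (Suc k)
    have "king_dist (p (n - s)) (p n) \<le> int n - int (n - s)"
      using king by (rule king_path_dist_le) simp
    then have "king_dist (p (n - s)) (p n) \<le> int s" by linarith
    then show ?thesis using fence_deleted_in_time[of "p n" "n - s"] free Suc by auto
  qed
  have inside: "king_dist (0, 0) (p n) < H" for n
  proof (induction n)
    case 0
    then show ?case using start H(1) by (simp add: king_dist_def)
  next
    case (Suc n)
    have "king_dist (0, 0) (p (Suc n)) \<le> king_dist (0, 0) (p n) + 1"
      using king_dist_triangle[of "(0, 0)" "p (Suc n)" "p n"] king_move_dist[OF king, of n]
      by linarith
    moreover have "king_dist (0, 0) (p (Suc n)) \<noteq> H" using off[of "Suc n"] unfolding fence_def by simp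
    ultimately show ?case using Suc by linarith
  qed
  have "p n \<in> box" for n
    using inside[of n] by (cases "p n") (auto simp: box_def king_dist_def)
  then have "p (Suc (card box + s)) \<in> deleted (Suc (card box + s) - s)"
    using box_deleted_eventually deleted_mono[of "card box" "Suc (card box + s) - s"] by auto
  then show False using free by blast
qed

end

lemma winning_devil: "winning_devil_strategy s devil"
  unfolding winning_devil_strategy_def
proof (intro conjI allI impI)
  show "devil_strategy devil" by (rule devil_strategy_devil)
  fix p assume play: "angel_play s devil p"
  show "devil_wins s devil p"
  proof (rule ccontr)
    assume "\<not> devil_wins s devil p"
    then have legal: "angel_legal s devil p n (p (Suc n))" for n
      using play unfolding angel_play_def devil_wins_def by blast
    have start: "p 0 = (0, 0)" using play unfolding angel_play_def by simp
    have king: "king_move (p n) (p (Suc n))" for n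
      using legal[of n] unfolding angel_legal_def by simp
    obtain n where "p (Suc n) \<in> set (deletions devil p (Suc n - s))"
      using path_blocked[of p] start king by blast
    then show False
      using legal[of n] unfolding angel_legal_def by simp
  qed
qed

end

section \<open>Choice of the constants\<close>

text \<open>
  With \<open>M = 80\<close> the five residue classes of the top level take up half of the \<open>H\<close> turns that the
  Angel needs to reach the fence, which leaves the other half for the corners. Then \<open>B\<close> only has to
  exceed \<open>2 * 75 * 80 + 5 * s\<close>, and \<open>H\<close> has to be a large enough multiple of \<open>Q\<close>.
\<close>

theorem theorem4:
  fixes s :: nat
  shows "\<exists>\<sigma>. winning_devil_strategy s \<sigma>"
proof -
  define B :: int where "B = 12001 + 5 * int s"
  define Q :: int where "Q = B * 2 ^ 75"
  have "B \<ge> 12001" unfolding B_def by simp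
  then have "Q \<ge> 12001" unfolding Q_def by simp
  interpret fencing s 75 80 B Q "4 * Q + 1" "70 * Q"
    using \<open>Q \<ge> 12001\<close> by unfold_locales (simp_all add: B_def Q_def)
  show ?thesis using winning_devil by blast
qed

end
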